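(* Let $\Lambda>0$ and $0<\theta<1$ be fixed. Let $(\alpha_n)_{n\in\mathbb{N}}$ be a decreasing sequence such that $0<\alpha_n<1$ and $\alpha_n\to0$ as $n\to\infty$. For each $n$ let $(c_n,R_n,v_n(\xi))$ denote the corresponding solution of $$\begin{cases}\Lambda v_n''-c_nv_n'=v_n^{\alpha_n},\quad 0<\xi<R_n,\\ v_n(0)\in I,\quad v_n'(0)=-\dfrac{c_n}{\Lambda}(1-v_n(0)),\\ v_n(R_n)=v_n'(R_n)=0,\end{cases}$$ together with $$\theta+\Lambda v_n(0)=1-c_n(1-\Lambda)\int_0^{R_n}e^{-c_ns}v_n(s)\,ds.$$ Then $(c_n,R_n,v_n(\xi))_{n\in\mathbb{N}}$ converges to the unique solution $(c,R,v(\xi))$ of the limit system $$\begin{cases}\Lambda v''-cv'=1,\quad 0<\xi<R,\\ v(0)\in I,\quad v'(0)=-\dfrac{c}{\Lambda}(1-v(0)),\\ v(R)=v'(R)=0,\end{cases}$$ together with $$\theta+\Lambda v(0)=1-c(1-\Lambda)\int_0^Re^{-cs}v(s)\,ds,$$ where $c=R$ is uniquely given as the strictly positive solution of $e^{c^2}=\dfrac1{1-c^2\theta}$.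
   Context: The interval $I$ is $I=[1-\theta,1-\Lambda\theta]$ if $0<\Lambda<1$, $I=[(1-\theta)/\Lambda,1-\theta/\Lambda]$ if $\Lambda>1$, and $I=\{1-\theta\}$ if $\Lambda=1$. With each $\alpha_n$ one such solution is associated; solutions are understood with $c_n>0$, $0<R_n<+\infty$, $v_n\in C^\infty([0,R_n))\cap C^1([0,R_n])$, $v_n>0$ on $[0,R_n)$ (and similarly $c>0$, $0<R<+\infty$ for the limit system). *)

theory Defs
  imports "HOL-Analysis.Analysis"
begin

definition I_set :: "real \<Rightarrow> real \<Rightarrow> real set" where
  "I_set \<Lambda> \<theta> =
     (if \<Lambda> < 1 then {1 - \<theta> .. 1 - \<Lambda> * \<theta>}
      else if \<Lambda> > 1 then {(1 - \<theta>) / \<Lambda> .. 1 - \<theta> / \<Lambda>}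
      else {1 - \<theta>})"

text \<open>
  Regularity classes on a (half-)closed interval \<open>S\<close>. Derivatives are taken within \<open>S\<close>, hence
  are one-sided at an endpoint that belongs to \<open>S\<close>, and only the values of \<open>f\<close> on \<open>S\<close> matter.
  (The library's \<open>C1_differentiable_on\<close> uses two-sided derivatives and does not fit.)
\<close>

definition C1_on :: "real set \<Rightarrow> (real \<Rightarrow> real) \<Rightarrow> bool" where
  "C1_on S f \<longleftrightarrow>
     (\<exists>f'. (\<forall>x\<in>S. (f has_real_derivative f' x) (at x within S)) \<and> continuous_on S f')"

definition C_inf_on :: "real set \<Rightarrow> (real \<Rightarrow> real) \<Rightarrow> bool" where
  "C_inf_on S f \<longleftrightarrow>
     (\<exists>D :: nat \<Rightarrow> real \<Rightarrow> real. (\<forall>x\<in>S. D 0 x = f x) \<and>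
        (\<forall>k. \<forall>x\<in>S. (D k has_real_derivative D (Suc k) x) (at x within S)))"

text \<open>
  The free boundary system with reaction term \<open>g v\<close>; it is used with \<open>g u = u powr \<alpha>\<close> and with
  \<open>g u = 1\<close>. Only the values of \<open>v\<close> on \<open>[0,R]\<close> are relevant. Positivity of \<open>v\<close> on \<open>[0,R)\<close> is
  kept separate.
\<close>

definition fb_solution ::
  "real \<Rightarrow> real \<Rightarrow> (real \<Rightarrow> real) \<Rightarrow> real \<Rightarrow> real \<Rightarrow> (real \<Rightarrow> real) \<Rightarrow> bool" where
  "fb_solution \<Lambda> \<theta> g c R v \<longleftrightarrow>
     0 < c \<and> 0 < R \<and> C_inf_on {0..<R} v \<and> C1_on {0..R} v \<and>
     (\<forall>\<xi>\<in>{0<..<R}. \<Lambda> * deriv (deriv v) \<xi> - c * deriv v \<xi> = g (v \<xi>)) \<and>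
     v 0 \<in> I_set \<Lambda> \<theta> \<and>
     (v has_real_derivative (- (c / \<Lambda>) * (1 - v 0))) (at 0 within {0..R}) \<and>
     v R = 0 \<and> (v has_real_derivative 0) (at R within {0..R}) \<and>
     \<theta> + \<Lambda> * v 0 = 1 - c * (1 - \<Lambda>) * integral {0..R} (\<lambda>s. exp (- c * s) * v s)"

text \<open>
  The profiles live on intervals \<open>[0,R\<^sub>n]\<close> that vary with \<open>n\<close>. Since \<open>v\<close> and \<open>v'\<close> vanish at
  \<open>R\<close>, the extension by zero is of class \<open>C\<^sup>1\<close> on \<open>[0,\<infinity>)\<close>; convergence of profiles is
  convergence of these extensions in \<open>C\<^sup>1([0,\<infinity>))\<close>, i.e. uniform convergence of the functions
  and of their first derivatives.
\<close>

definition zero_ext :: "real \<Rightarrow> (real \<Rightarrow> real) \<Rightarrow> real \<Rightarrow> real" where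
  "zero_ext R v x = (if x \<le> R then v x else 0)"

definition profiles_converge ::
  "(nat \<Rightarrow> real) \<Rightarrow> (nat \<Rightarrow> real \<Rightarrow> real) \<Rightarrow> real \<Rightarrow> (real \<Rightarrow> real) \<Rightarrow> bool" where
  "profiles_converge R v R' v' \<longleftrightarrow>
     uniform_limit {0..} (\<lambda>n. zero_ext (R n) (v n)) (zero_ext R' v') sequentially \<and>
     uniform_limit {0..} (\<lambda>n x. vector_derivative (zero_ext (R n) (v n)) (at x within {0..}))
       (\<lambda>x. vector_derivative (zero_ext R' v') (at x within {0..})) sequentially"

end

theory Submission
  imports Defs
begin

text \<open>
  The argument runs through the flux \<open>F = c v - \<Lambda> v'\<close>. The differential equation becomes
  \<open>F' = - g (v)\<close>, the boundary conditions become \<open>F 0 = c\<close> and \<open>F R = 0\<close>, and the integral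
  condition becomes \<open>\<integral>\<^sub>0\<^sup>R e\<^sup>-\<^sup>c\<^sup>s F(s) ds = 1 - \<theta>\<close>, with no dependence on \<open>\<Lambda>\<close> left. For \<open>g = 1\<close> this forces
  \<open>F(s) = R - s\<close>, hence \<open>c = R\<close>, and \<open>\<phi>(c\<^sup>2) = \<theta>\<close> for the strictly decreasing function
  \<open>\<phi>(x) = (1 - e\<^sup>-\<^sup>x) / x\<close>.

  For \<open>g(u) = u\<^sup>\<alpha>\<close> one has \<open>0 \<le> v \<le> 1\<close>, so \<open>c - s \<le> F(s) \<le> R - s\<close>, and everything reduces to
  \<open>R\<^sub>n - c\<^sub>n \<rightarrow> 0\<close>: the integral condition then gives \<open>\<phi>(c\<^sub>n\<^sup>2) \<rightarrow> \<theta>\<close>, and a maximum principle for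
  \<open>\<Lambda> v' = c v - F\<close> carries the convergence of the fluxes over to the profiles. The bound on
  \<open>R\<^sub>n - c\<^sub>n\<close> comes from an energy inequality at the free boundary, which bounds \<open>v\<^sup>\<alpha>\<close> from below by
  \<open>F\<^sup>1\<^sup>-\<^sup>\<beta>\<close> up to a factor tending to 1, where \<open>\<beta> = (1 - \<alpha>) / (1 + \<alpha>) \<rightarrow> 1\<close>. Integrating
  \<open>- F' = v\<^sup>\<alpha>\<close> from the free boundary shows that \<open>F(R - h)\<close> is asymptotically at least \<open>h\<close>.
\<close>

subsection \<open>Flux formulation\<close>

text \<open>Integrating factor: \<open>exp (-\<kappa> * x) * d x\<close> has derivative
  \<open>- exp (-\<kappa> * x) * e x \<le> 0\<close>, so a sign known at \<open>b\<close> propagates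
  to the left. The profiles are pinned at the free boundary, which is why comparisons run in this
  direction.\<close>

lemma backward_nonneg:
  fixes d e :: "real \<Rightarrow> real"
  assumes "a \<le> b" and cont: "continuous_on {a..b} d"
    and deriv: "\<And>x. a < x \<Longrightarrow> x < b \<Longrightarrow> (d has_real_derivative \<kappa> * d x - e x) (at x)"
    and nonneg: "\<And>x. a < x \<Longrightarrow> x < b \<Longrightarrow> 0 \<le> e x"
    and "0 \<le> d b"
  shows "0 \<le> d a"
proof -
  have "exp (-\<kappa> * b) * d b \<le> exp (-\<kappa> * a) * d a"
  proof (rule DERIV_nonpos_imp_decreasing_open[OF \<open>a \<le> b\<close>])
    fix x assume x: "a < x" "x < b"
    have "((\<lambda>x. exp (-\<kappa> * x) * d x) has_real_derivative - exp (-\<kappa> * x) * e x) (at x)"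
      by (auto intro!: derivative_eq_intros deriv[OF x] simp: algebra_simps)
    moreover have "- exp (-\<kappa> * x) * e x \<le> 0"
      using nonneg[OF x] by simp
    ultimately show "\<exists>y. ((\<lambda>x. exp (-\<kappa> * x) * d x) has_real_derivative y) (at x) \<and> y \<le> 0"
      by blast
  qed (intro continuous_intros cont)
  moreover have "0 \<le> exp (-\<kappa> * b) * d b"
    using \<open>0 \<le> d b\<close> by simp
  ultimately show ?thesis
    by (smt (verit) exp_gt_zero mult_pos_neg)
qed

text \<open>The constant \<open>\<epsilon> / \<kappa>\<close> is a barrier:
  \<open>\<epsilon> / \<kappa> + d\<close> and \<open>\<epsilon> / \<kappa> - d\<close> solve the
  same equation with sources \<open>\<epsilon> + e\<close> and \<open>\<epsilon> - e\<close>, both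
  nonnegative. The bound does not depend on \<open>b - a\<close>, so it becomes uniform on the
  half-line later.\<close>

lemma backward_bound:
  fixes d e :: "real \<Rightarrow> real"
  assumes "a \<le> b" and cont: "continuous_on {a..b} d" and "0 < \<kappa>"
    and deriv: "\<And>x. a < x \<Longrightarrow> x < b \<Longrightarrow> (d has_real_derivative \<kappa> * d x - e x) (at x)"
    and bound: "\<And>x. a < x \<Longrightarrow> x < b \<Longrightarrow> \<bar>e x\<bar> \<le> \<epsilon>"
    and "0 \<le> \<epsilon>" and "d b = 0"
  shows "\<bar>d a\<bar> \<le> \<epsilon> / \<kappa>"
proof -
  have "0 \<le> \<epsilon> / \<kappa> + d a"
  proof (rule backward_nonneg[OF \<open>a \<le> b\<close>, where d = "\<lambda>x. \<epsilon> / \<kappa> + d x"])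
    fix x assume x: "a < x" "x < b"
    show "((\<lambda>x. \<epsilon> / \<kappa> + d x) has_real_derivative \<kappa> * (\<epsilon> / \<kappa> + d x) - (\<epsilon> + e x)) (at x)"
      using \<open>0 < \<kappa>\<close> by (auto intro!: derivative_eq_intros deriv[OF x] simp: field_simps)
    show "0 \<le> \<epsilon> + e x"
      using bound[OF x] by linarith
  qed (use assms in \<open>auto intro!: continuous_intros\<close>)
  moreover have "0 \<le> \<epsilon> / \<kappa> - d a"
  proof (rule backward_nonneg[OF \<open>a \<le> b\<close>, where d = "\<lambda>x. \<epsilon> / \<kappa> - d x"])
    fix x assume x: "a < x" "x < b"
    show "((\<lambda>x. \<epsilon> / \<kappa> - d x) has_real_derivative \<kappa> * (\<epsilon> / \<kappa> - d x) - (\<epsilon> - e x)) (at x)"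
      using \<open>0 < \<kappa>\<close> by (auto intro!: derivative_eq_intros deriv[OF x] simp: field_simps)
    show "0 \<le> \<epsilon> - e x"
      using bound[OF x] by linarith
  qed (use assms in \<open>auto intro!: continuous_intros\<close>)
  ultimately show ?thesis
    by linarith
qed

text \<open>The derivative clause encodes \<open>F = c * v - \<Lambda> * v'\<close>. Then
  \<open>F 0 = c\<close> is the slope condition at 0, and \<open>F R = 0\<close> with
  \<open>v R = 0\<close> makes the slope vanish at \<open>R\<close>. The reaction term is left out
  so that the power problem and the limit problem share this form.\<close>

definition flux_form ::
  "real \<Rightarrow> real \<Rightarrow> real \<Rightarrow> (real \<Rightarrow> real) \<Rightarrow> (real \<Rightarrow> real) \<Rightarrow> bool" where
  "flux_form \<Lambda> c R v F \<longleftrightarrow>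
     0 < c \<and> 0 < R \<and> v R = 0 \<and> F R = 0 \<and> F 0 = c \<and> continuous_on {0..R} F \<and>
     (\<forall>x\<in>{0..R}. (v has_real_derivative (c * v x - F x) / \<Lambda>) (at x within {0..R}))"

lemma flux_form_deriv_at:
  assumes "flux_form \<Lambda> c R v F" "0 < x" "x < R"
  shows "(v has_real_derivative (c * v x - F x) / \<Lambda>) (at x)"
  using assms by (auto simp: flux_form_def at_within_Icc_at dest!: bspec[of _ _ x])

lemma flux_form_continuous:
  assumes "flux_form \<Lambda> c R v F"
  shows "continuous_on {0..R} v"
  using assms unfolding flux_form_def
  by (meson DERIV_continuous continuous_on_eq_continuous_within)

text \<open>Integrate the derivative
  \<open>exp (- c * s) * (c * (1 - \<Lambda>) * v s - F s)\<close> of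
  \<open>\<Lambda> * exp (- c * s) * v s\<close>. The integral condition of the system says exactly
  that the value obtained here is \<open>1 - \<theta>\<close>.\<close>

lemma flux_form_has_integral:
  assumes flux: "flux_form \<Lambda> c R v F" and "0 < \<Lambda>"
  shows "((\<lambda>s. exp (- c * s) * F s) has_integral
      c * (1 - \<Lambda>) * integral {0..R} (\<lambda>s. exp (- c * s) * v s) + \<Lambda> * v 0) {0..R}"
proof -
  have R: "0 < R" "v R = 0"
    using flux by (auto simp: flux_form_def)
  have "((\<lambda>s. exp (- c * s) * (c * (1 - \<Lambda>) * v s - F s)) has_integral
      \<Lambda> * (exp (- c * R) * v R) - \<Lambda> * (exp (- c * 0) * v 0)) {0..R}"
  proof (rule fundamental_theorem_of_calculus)
    fix x assume x: "x \<in> {0..R}"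
    then have "(v has_real_derivative (c * v x - F x) / \<Lambda>) (at x within {0..R})"
      using flux by (auto simp: flux_form_def)
    then have "((\<lambda>s. \<Lambda> * (exp (- c * s) * v s)) has_real_derivative
        exp (- c * x) * (c * (1 - \<Lambda>) * v x - F x)) (at x within {0..R})"
      using \<open>0 < \<Lambda>\<close> by (auto intro!: derivative_eq_intros simp: field_simps)
    then show "((\<lambda>s. \<Lambda> * (exp (- c * s) * v s)) has_vector_derivative
        exp (- c * x) * (c * (1 - \<Lambda>) * v x - F x)) (at x within {0..R})"
      by (simp add: has_real_derivative_iff_has_vector_derivative)
  qed (use R in simp)
  moreover have "((\<lambda>s. c * (1 - \<Lambda>) * (exp (- c * s) * v s)) has_integral
      c * (1 - \<Lambda>) * integral {0..R} (\<lambda>s. exp (- c * s) * v s)) {0..R}"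
    by (intro has_integral_mult_right integrable_integral integrable_continuous_interval
        continuous_intros flux_form_continuous[OF flux])
  ultimately have "((\<lambda>s. c * (1 - \<Lambda>) * (exp (- c * s) * v s) -
        exp (- c * s) * (c * (1 - \<Lambda>) * v s - F s)) has_integral
      c * (1 - \<Lambda>) * integral {0..R} (\<lambda>s. exp (- c * s) * v s) -
        (\<Lambda> * (exp (- c * R) * v R) - \<Lambda> * (exp (- c * 0) * v 0))) {0..R}"
    by (intro has_integral_diff)
  then show ?thesis
    by (simp add: R algebra_simps)
qed

lemma fb_solution_flux_form:
  assumes "0 < \<Lambda>" and sol: "fb_solution \<Lambda> \<theta> g c R v"
  obtains F where "flux_form \<Lambda> c R v F"
    and "\<And>x. 0 < x \<Longrightarrow> x < R \<Longrightarrow> (F has_real_derivative - g (v x)) (at x)"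
    and "((\<lambda>s. exp (- c * s) * F s) has_integral 1 - \<theta>) {0..R}"
proof -
  have pos: "0 < c" "0 < R" and vR: "v R = 0"
    and ode: "\<And>x. 0 < x \<Longrightarrow> x < R \<Longrightarrow> \<Lambda> * deriv (deriv v) x - c * deriv v x = g (v x)"
    and v0: "(v has_real_derivative (- (c / \<Lambda>) * (1 - v 0))) (at 0 within {0..R})"
    and v'R: "(v has_real_derivative 0) (at R within {0..R})"
    and int: "\<theta> + \<Lambda> * v 0 = 1 - c * (1 - \<Lambda>) * integral {0..R} (\<lambda>s. exp (- c * s) * v s)"
    and "C_inf_on {0..<R} v" "C1_on {0..R} v"
    using sol by (auto simp: fb_solution_def)
  then obtain D v' where D0: "\<And>x. x \<in> {0..<R} \<Longrightarrow> D 0 x = v x"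
    and D: "\<And>k x. x \<in> {0..<R} \<Longrightarrow> (D k has_real_derivative D (Suc k) x) (at x within {0..<R})"
    and v': "\<And>x. x \<in> {0..R} \<Longrightarrow> (v has_real_derivative v' x) (at x within {0..R})"
    and cont: "continuous_on {0..R} v'"
    unfolding C_inf_on_def C1_on_def by metis
  define F where "F = (\<lambda>x. c * v x - \<Lambda> * v' x)"
  \<comment> \<open>\<open>C1_on\<close> only provides some derivative \<open>v'\<close>; uniqueness
    of one-sided derivatives identifies its endpoint values with the prescribed ones.\<close>
  have unique: "D = D'"
    if "(v has_real_derivative D) (at x within {0..R})" "(v has_real_derivative D') (at x within {0..R})"
      "x \<in> {0..R}" for x D D'
    using that pos vector_derivative_unique_within[of x "{0..R}" v D D']
    by (simp add: has_real_derivative_iff_has_vector_derivative trivial_limit_within)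
  have v'_0: "v' 0 = - (c / \<Lambda>) * (1 - v 0)"
    using unique[OF v' v0] pos by simp
  have v'_R: "v' R = 0"
    using unique[OF v' v'R] pos by simp
  have flux: "flux_form \<Lambda> c R v F"
    using v' pos vR cont DERIV_continuous_on[OF v'] \<open>0 < \<Lambda>\<close>
    by (auto simp: flux_form_def F_def v'_0 v'_R algebra_simps intro!: continuous_intros)
  moreover have "(F has_real_derivative - g (v x)) (at x)" if x: "0 < x" "x < R" for x
  proof -
    \<comment> \<open>At interior points derivatives within \<open>{0..<R}\<close> are two-sided, so
      \<open>D 1\<close> agrees with both \<open>v'\<close> and \<open>deriv v\<close>. This turns
      the equation for \<open>deriv (deriv v)\<close> into one for the derivative of
      \<open>F\<close>.\<close>
    have at: "at y within {0..<R} = at y" if "0 < y" "y < R" for y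
      using that by (intro at_within_interior) (auto simp: interior_atLeastLessThan)
    have DD: "(D k has_real_derivative D (Suc k) y) (at y)" if "0 < y" "y < R" for k y
      using D[of y k] at[OF that] that by simp
    have Dv: "(v has_real_derivative D 1 y) (at y)" if "0 < y" "y < R" for y
    proof (rule has_field_derivative_transform_within_open)
      show "(D 0 has_real_derivative D 1 y) (at y)"
        using DD[OF that, of 0] by simp
      show "open {0<..<R}" "y \<in> {0<..<R}"
        using that by auto
    qed (use D0 in auto)
    have v'D: "v' y = D 1 y" if "0 < y" "y < R" for y
      using v'[of y] Dv[OF that] that by (auto simp: at_within_Icc_at intro: DERIV_unique)
    have dv: "deriv v y = D 1 y" if "0 < y" "y < R" for y
      using Dv[OF that] by (rule DERIV_imp_deriv)
    have tr: "(f has_real_derivative D 2 x) (at x)" if "\<And>y. 0 < y \<Longrightarrow> y < R \<Longrightarrow> f y = D 1 y" for f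
    proof (rule has_field_derivative_transform_within_open)
      show "(D 1 has_real_derivative D 2 x) (at x)"
        using DD[OF x, of 1] by (simp add: numeral_2_eq_2)
      show "open {0<..<R}" "x \<in> {0<..<R}"
        using x by auto
    qed (use that in auto)
    have "deriv (deriv v) x = D 2 x"
      using tr[of "deriv v"] dv by (intro DERIV_imp_deriv) auto
    then have "- g (v x) = c * D 1 x - \<Lambda> * D 2 x"
      using ode[OF x] dv[OF x] by simp
    then show ?thesis
      using Dv[OF x] tr[of v'] v'D
      by (auto simp: F_def intro!: derivative_eq_intros)
  qed
  moreover have "((\<lambda>s. exp (- c * s) * F s) has_integral 1 - \<theta>) {0..R}"
  proof -
    have "c * (1 - \<Lambda>) * integral {0..R} (\<lambda>s. exp (- c * s) * v s) + \<Lambda> * v 0 = 1 - \<theta>"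
      using int by linarith
    with flux_form_has_integral[OF flux \<open>0 < \<Lambda>\<close>] show ?thesis
      by simp
  qed
  ultimately show thesis
    by (rule that)
qed

subsection \<open>Integral condition and a priori bounds\<close>

text \<open>For \<open>x > 0\<close> this is the mean of \<open>exp (- t)\<close> over
  \<open>{0..x}\<close>, the function \<phi> of the overview.\<close>

definition exp_avg :: "real \<Rightarrow> real" where
  "exp_avg x = (1 - exp (- x)) / x"

lemma exp_avg_strict_antimono:
  assumes "0 < x" "x < y"
  shows "exp_avg y < exp_avg x"
proof (rule DERIV_neg_imp_decreasing[OF \<open>x < y\<close>])
  fix t assume "x \<le> t" "t \<le> y"
  with \<open>0 < x\<close> have "0 < t" by simp
  have "(exp_avg has_real_derivative (exp (- t) * t - (1 - exp (- t))) / t\<^sup>2) (at t)"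
    using \<open>0 < t\<close> unfolding exp_avg_def[abs_def]
    by (auto intro!: derivative_eq_intros simp: power2_eq_square)
  moreover have "exp (- t) * t - (1 - exp (- t)) < 0"
  proof -
    have "exp (- t) * (1 + t) < exp (- t) * exp t"
      using exp_minus_greater[of "- t"] \<open>0 < t\<close> by (intro mult_strict_left_mono) auto
    then show ?thesis
      by (simp add: algebra_simps flip: exp_add)
  qed
  ultimately show "\<exists>d. (exp_avg has_real_derivative d) (at t) \<and> d < 0"
    using \<open>0 < t\<close> by (intro exI conjI) (auto intro: divide_neg_pos)
qed

text \<open>Intermediate values between \<open>- ln \<theta>\<close> and
  \<open>1 / \<theta>\<close>. At \<open>1 / \<theta>\<close> the function is \<theta> times a
  number below 1; at \<open>- ln \<theta>\<close> it equals
  \<open>(1 - \<theta>) / - ln \<theta>\<close>, which is at least \<theta> because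
  \<open>ln (1 / \<theta>) \<le> 1 / \<theta> - 1\<close>.\<close>

lemma exp_avg_attains:
  assumes "0 < \<theta>" "\<theta> < 1"
  obtains x where "0 < x" "exp_avg x = \<theta>"
proof -
  have pos: "0 < - ln \<theta>"
    using assms by simp
  have "- ln \<theta> \<le> 1 / \<theta>"
    using assms ln_le_minus_one[of "1 / \<theta>"] by (simp add: ln_div)
  moreover have "exp_avg (1 / \<theta>) \<le> \<theta>"
    using assms by (simp add: exp_avg_def)
  moreover have "\<theta> \<le> exp_avg (- ln \<theta>)"
  proof -
    have "\<theta> * - ln \<theta> \<le> 1 - \<theta>"
      using assms ln_le_minus_one[of "1 / \<theta>"] by (simp add: ln_div field_simps)
    moreover have "exp_avg (- ln \<theta>) = (1 - \<theta>) / - ln \<theta>"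
      using assms by (simp add: exp_avg_def)
    ultimately show ?thesis
      using pos by (simp only: pos_le_divide_eq)
  qed
  moreover have "continuous_on {- ln \<theta>..1 / \<theta>} exp_avg"
    using pos unfolding exp_avg_def[abs_def] by (intro continuous_intros) auto
  ultimately obtain x where "- ln \<theta> \<le> x" "exp_avg x = \<theta>"
    using IVT2'[of exp_avg "1 / \<theta>" \<theta> "- ln \<theta>"] by auto
  with pos show thesis
    by (intro that[of x]) auto
qed

lemma exp_square_eq_iff_exp_avg:
  assumes "0 < x"
  shows "exp (x\<^sup>2) = 1 / (1 - x\<^sup>2 * \<theta>) \<longleftrightarrow> exp_avg (x\<^sup>2) = \<theta>"
proof -
  \<comment> \<open>Inversion is an involution with \<open>inverse 0 = 0\<close>, so the equivalence
    also covers a vanishing denominator, where both sides are false.\<close>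
  have "exp (x\<^sup>2) = 1 / (1 - x\<^sup>2 * \<theta>) \<longleftrightarrow> exp (- x\<^sup>2) = 1 - x\<^sup>2 * \<theta>"
    by (metis exp_minus inverse_eq_divide inverse_inverse_eq)
  also have "\<dots> \<longleftrightarrow> exp_avg (x\<^sup>2) = \<theta>"
    using assms by (auto simp: exp_avg_def field_simps)
  finally show ?thesis .
qed

lemma has_integral_exp_linear:
  fixes c R :: real
  assumes "0 < c" "0 \<le> R"
  shows "((\<lambda>s. exp (- c * s) * (R - s)) has_integral R / c - (1 - exp (- c * R)) / c\<^sup>2) {0..R}"
proof -
  let ?A = "\<lambda>s. exp (- c * s) * (1 / c\<^sup>2 - (R - s) / c)"
  have "((\<lambda>s. exp (- c * s) * (R - s)) has_integral ?A R - ?A 0) {0..R}"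
  proof (rule fundamental_theorem_of_calculus)
    fix s
    have "(?A has_real_derivative exp (- c * s) * (R - s)) (at s within {0..R})"
      using assms by (auto intro!: derivative_eq_intros simp: field_simps power2_eq_square)
    then show "(?A has_vector_derivative exp (- c * s) * (R - s)) (at s within {0..R})"
      by (simp add: has_real_derivative_iff_has_vector_derivative)
  qed (fact assms)
  then show ?thesis
    using assms by (simp add: field_simps)
qed

text \<open>For the limit flux \<open>c - s\<close> the integral condition thus becomes
  \<open>exp_avg (c\<^sup>2) = \<theta>\<close>.\<close>

lemma has_integral_exp_linear_diag:
  fixes c :: real
  assumes "0 < c"
  shows "((\<lambda>s. exp (- c * s) * (c - s)) has_integral 1 - exp_avg (c\<^sup>2)) {0..c}"
  using has_integral_exp_linear[of c c] assms by (simp add: exp_avg_def power2_eq_square)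

text \<open>The difference \<open>F - c * v\<close>, which is \<open>- \<Lambda> * v'\<close>,
  solves a backward equation with source \<open>v powr \<alpha> \<ge> 0\<close>, hence is
  nonnegative. So \<open>v\<close> decreases from \<open>v 0 \<le> 1\<close>, the slope of
  \<open>F\<close> lies between -1 and 0, and \<open>F x + x\<close> is increasing. Comparison with
  both endpoints gives the linear bounds.\<close>

lemma power_flux_bounds:
  assumes flux: "flux_form \<Lambda> c R v F" and "0 < \<Lambda>"
    and F': "\<And>x. 0 < x \<Longrightarrow> x < R \<Longrightarrow> (F has_real_derivative - (v x powr \<alpha>)) (at x)"
    and "0 < \<alpha>" and nonneg: "\<And>x. 0 < x \<Longrightarrow> x < R \<Longrightarrow> 0 \<le> v x" and "v 0 \<le> 1"
    and x: "x \<in> {0..R}"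
  shows "c * v x \<le> F x" and "v x \<le> 1" and "c - x \<le> F x" and "F x \<le> R - x"
    and "0 \<le> F x"
proof -
  have pos: "0 < c" "0 < R" and zero: "v R = 0" "F R = 0" "F 0 = c" and cF: "continuous_on {0..R} F"
    using flux by (auto simp: flux_form_def)
  have cont: "continuous_on {a..b} F" "continuous_on {a..b} v" if "0 \<le> a" "b \<le> R" for a b
    using cF flux_form_continuous[OF flux] that by (auto intro: continuous_on_subset)
  have v': "(v has_real_derivative (c * v y - F y) / \<Lambda>) (at y)" if "0 < y" "y < R" for y
    by (rule flux_form_deriv_at[OF flux that])
  have le: "c * v y \<le> F y" if "0 \<le> y" "y \<le> R" for y
  proof -
    have "0 \<le> F y - c * v y"
    proof (rule backward_nonneg[OF \<open>y \<le> R\<close>])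
      fix z assume "y < z" "z < R"
      with that have z: "0 < z" "z < R" by auto
      show "((\<lambda>z. F z - c * v z) has_real_derivative c / \<Lambda> * (F z - c * v z) - v z powr \<alpha>) (at z)"
        by (rule derivative_eq_intros F'[OF z] v'[OF z] refl)+
          (use \<open>0 < \<Lambda>\<close> in \<open>simp add: field_simps\<close>)
    qed (use that zero in \<open>auto intro!: continuous_intros cont\<close>)
    then show ?thesis by simp
  qed
  have v_le: "v y \<le> 1" if "0 \<le> y" "y \<le> R" for y
  proof -
    have "v y \<le> v 0"
    proof (rule DERIV_nonpos_imp_decreasing_open[OF \<open>0 \<le> y\<close>])
      fix z assume "0 < z" "z < y"
      with that have z: "0 < z" "z < R" by auto
      have "(c * v z - F z) / \<Lambda> \<le> 0"
        using le[of z] z \<open>0 < \<Lambda>\<close> by (simp add: divide_le_0_iff)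
      with v'[OF z] show "\<exists>d. (v has_real_derivative d) (at z) \<and> d \<le> 0"
        by blast
    qed (use that in \<open>auto intro: cont\<close>)
    with \<open>v 0 \<le> 1\<close> show ?thesis by simp
  qed
  have mono: "F a + a \<le> F b + b" if "0 \<le> a" "a \<le> b" "b \<le> R" for a b
  proof (rule DERIV_nonneg_imp_increasing_open[OF \<open>a \<le> b\<close>])
    fix z assume "a < z" "z < b"
    with that have z: "0 < z" "z < R" by auto
    have "((\<lambda>z. F z + z) has_real_derivative - (v z powr \<alpha>) + 1) (at z)"
      by (intro derivative_intros F'[OF z])
    moreover have "v z powr \<alpha> \<le> 1"
      using powr_mono2[of \<alpha> "v z" 1] v_le[of z] nonneg[OF z] z \<open>0 < \<alpha>\<close> by simp
    ultimately show "\<exists>d. ((\<lambda>z. F z + z) has_real_derivative d) (at z) \<and> 0 \<le> d"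
      by force
  qed (use that in \<open>auto intro!: continuous_intros cont\<close>)
  have "F R \<le> F x"
  proof (rule DERIV_nonpos_imp_decreasing_open[of x R F])
    fix z assume "x < z" "z < R"
    with x have z: "0 < z" "z < R" by auto
    show "\<exists>d. (F has_real_derivative d) (at z) \<and> d \<le> 0"
      using F'[OF z] by force
  qed (use x in \<open>auto intro!: cont\<close>)
  with zero show "0 \<le> F x" by simp
  show "c * v x \<le> F x" "v x \<le> 1"
    using x le v_le by auto
  show "c - x \<le> F x" "F x \<le> R - x"
    using x mono[of 0 x] mono[of x R] zero by auto
qed

text \<open>Split at \<open>c\<close> and compare \<open>F\<close> with the limit flux
  \<open>c - s\<close> on \<open>{0..c}\<close> and with 0 on \<open>{c..R}\<close>. The excess is
  at most \<open>R - c\<close> on both pieces and the weight at most 1, so the total error is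
  \<open>(R - c) * R\<close>.\<close>

lemma flux_integral_bounds:
  fixes c R \<theta> :: real
  assumes "0 < c" "c \<le> R" and cont: "continuous_on {0..R} F"
    and int: "((\<lambda>s. exp (- c * s) * F s) has_integral 1 - \<theta>) {0..R}"
    and lower: "\<And>x. x \<in> {0..R} \<Longrightarrow> c - x \<le> F x"
    and upper: "\<And>x. x \<in> {0..R} \<Longrightarrow> F x \<le> R - x"
    and nonneg: "\<And>x. x \<in> {0..R} \<Longrightarrow> 0 \<le> F x"
  shows "\<theta> \<le> exp_avg (c\<^sup>2)" and "exp_avg (c\<^sup>2) \<le> \<theta> + (R - c) * R"
proof -
  define f where "f = (\<lambda>s. exp (- c * s) * F s)"
  have on: "f integrable_on {a..b}" if "0 \<le> a" "b \<le> R" for a b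
    unfolding f_def
    by (intro integrable_continuous_interval continuous_intros continuous_on_subset[OF cont])
      (use that in auto)
  have "integral {0..c} f + integral {c..R} f = integral {0..R} f"
    using assms by (intro Henstock_Kurzweil_Integration.integral_combine on) auto
  also have "\<dots> = 1 - \<theta>"
    using int unfolding f_def by (rule integral_unique)
  finally have split: "integral {0..c} f + integral {c..R} f = 1 - \<theta>" .
  have on0: "(f has_integral integral {0..c} f) {0..c}" and on1: "(f has_integral integral {c..R} f) {c..R}"
    using on \<open>0 < c\<close> \<open>c \<le> R\<close> by (auto intro!: integrable_integral)
  have e1: "exp (- c * s) \<le> 1" if "0 \<le> s" for s
    using that \<open>0 < c\<close> by simp
  have small: "f s \<le> exp (- c * s) * (c - s) + (R - c)" if "s \<in> {0..c}" for s
  proof -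
    have "f s \<le> exp (- c * s) * (c - s + (R - c))"
      unfolding f_def using upper[of s] that \<open>c \<le> R\<close> by (intro mult_left_mono) auto
    also have "\<dots> = exp (- c * s) * (c - s) + exp (- c * s) * (R - c)"
      by (simp add: algebra_simps)
    also have "\<dots> \<le> exp (- c * s) * (c - s) + 1 * (R - c)"
      using that \<open>c \<le> R\<close> by (intro add_left_mono mult_right_mono e1) auto
    finally show ?thesis by simp
  qed
  have large: "f s \<le> R - c" if "s \<in> {c..R}" for s
  proof -
    have "f s \<le> 1 * (R - c)"
      unfolding f_def using upper[of s] nonneg[of s] that \<open>0 < c\<close> by (intro mult_mono e1) auto
    then show ?thesis by simp
  qed
  have "1 - exp_avg (c\<^sup>2) \<le> integral {0..c} f"
    by (rule has_integral_le[OF has_integral_exp_linear_diag[OF \<open>0 < c\<close>] on0])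
      (use lower \<open>c \<le> R\<close> in \<open>auto simp: f_def intro!: mult_left_mono\<close>)
  moreover have "0 \<le> integral {c..R} f"
    by (rule has_integral_nonneg[OF on1]) (use nonneg \<open>0 < c\<close> in \<open>auto simp: f_def\<close>)
  moreover have "integral {0..c} f \<le> 1 - exp_avg (c\<^sup>2) + (R - c) * c"
  proof (rule has_integral_le[OF on0])
    show "((\<lambda>s. exp (- c * s) * (c - s) + (R - c)) has_integral 1 - exp_avg (c\<^sup>2) + (R - c) * c) {0..c}"
      using has_integral_const_real[of "R - c" 0 c] \<open>0 < c\<close>
      by (intro has_integral_add has_integral_exp_linear_diag) (auto simp: mult.commute)
  qed (rule small)
  moreover have "integral {c..R} f \<le> (R - c) * (R - c)"
  proof (rule has_integral_le[OF on1])
    show "((\<lambda>s. R - c) has_integral (R - c) * (R - c)) {c..R}"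
      using has_integral_const_real[of "R - c" c R] \<open>c \<le> R\<close> by simp
  qed (rule large)
  ultimately show "\<theta> \<le> exp_avg (c\<^sup>2)" "exp_avg (c\<^sup>2) \<le> \<theta> + (R - c) * R"
    using split by (auto simp: algebra_simps)
qed

subsection \<open>Growth of the flux at the free boundary\<close>

text \<open>
  For \<open>H = e\<^bsup>c(R-x)/\<Lambda>\<^esup> v\<close> one has \<open>H' = - e\<^bsup>c(R-x)/\<Lambda>\<^esup> F / \<Lambda>\<close>, and the factor is at least 1. Hence
  \<open>- H\<^sup>\<alpha> H' \<ge> F v\<^sup>\<alpha> / \<Lambda> = - F F' / \<Lambda>\<close>, which is integrated from the free boundary.
\<close>

lemma power_flux_energy:
  assumes flux: "flux_form \<Lambda> c R v F" and "0 < \<Lambda>"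
    and F': "\<And>x. 0 < x \<Longrightarrow> x < R \<Longrightarrow> (F has_real_derivative - (v x powr \<alpha>)) (at x)"
    and "0 < \<alpha>" and v_pos: "\<And>x. 0 \<le> x \<Longrightarrow> x < R \<Longrightarrow> 0 < v x" and "v 0 \<le> 1"
    and x: "0 \<le> x" "x \<le> R"
  shows "(F x)\<^sup>2 / (2 * \<Lambda>) \<le> (exp (c / \<Lambda> * (R - x)) * v x) powr (1 + \<alpha>) / (1 + \<alpha>)"
proof -
  have pos: "0 < c" "0 < R" and zero: "v R = 0" "F R = 0" and contF: "continuous_on {0..R} F"
    using flux by (auto simp: flux_form_def)
  have F_nonneg: "0 \<le> F y" if "y \<in> {0..R}" for y
    using power_flux_bounds(5)[OF flux \<open>0 < \<Lambda>\<close> F' \<open>0 < \<alpha>\<close> less_imp_le[OF v_pos] \<open>v 0 \<le> 1\<close> that]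
    by simp
  have v_nonneg: "0 \<le> v y" if "y \<in> {x..R}" for y
    using v_pos[of y] zero that x by (cases "y = R") (auto intro: less_imp_le)
  define E where "E = (\<lambda>y. exp (c / \<Lambda> * (R - y)))"
  define H where "H = (\<lambda>y. E y * v y)"
  define D where "D = (\<lambda>y. H y powr (1 + \<alpha>) / (1 + \<alpha>) - (F y)\<^sup>2 / (2 * \<Lambda>))"
  have "D R \<le> D x"
  proof (rule DERIV_nonpos_imp_decreasing_open[OF \<open>x \<le> R\<close>])
    fix y assume "x < y" "y < R"
    with x have y: "0 < y" "y < R" by auto
    have E: "1 \<le> E y"
      using y pos \<open>0 < \<Lambda>\<close> by (simp add: E_def)
    have H: "v y \<le> H y" "0 < H y"
      using E v_pos[of y] y by (auto simp: H_def)
    have "(H has_real_derivative - (E y * F y / \<Lambda>)) (at y)"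
      unfolding H_def E_def using \<open>0 < \<Lambda>\<close>
      by (auto intro!: derivative_eq_intros flux_form_deriv_at[OF flux y] simp: field_simps)
    from DERIV_fun_powr[OF this \<open>0 < H y\<close>, of "1 + \<alpha>"]
    have "((\<lambda>y. H y powr (1 + \<alpha>)) has_real_derivative
        (1 + \<alpha>) * H y powr \<alpha> * - (E y * F y / \<Lambda>)) (at y)"
      by simp
    from DERIV_diff[OF DERIV_cdivide[OF this] DERIV_cdivide[OF DERIV_power[OF F'[OF y], of 2]]]
    have "(D has_real_derivative (1 + \<alpha>) * H y powr \<alpha> * - (E y * F y / \<Lambda>) / (1 + \<alpha>)
        - of_nat 2 * (- (v y powr \<alpha>) * F y ^ (2 - Suc 0)) / (2 * \<Lambda>)) (at y)"
      unfolding D_def .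
    then have D': "(D has_real_derivative - (F y * (E y * H y powr \<alpha> - v y powr \<alpha>) / \<Lambda>)) (at y)"
    proof (rule DERIV_cong)
      have "(1 + \<alpha>) * H y powr \<alpha> * - (E y * F y / \<Lambda>) / (1 + \<alpha>) = - (H y powr \<alpha> * (E y * F y / \<Lambda>))"
        using \<open>0 < \<alpha>\<close> by simp
      then show "(1 + \<alpha>) * H y powr \<alpha> * - (E y * F y / \<Lambda>) / (1 + \<alpha>)
          - of_nat 2 * (- (v y powr \<alpha>) * F y ^ (2 - Suc 0)) / (2 * \<Lambda>)
          = - (F y * (E y * H y powr \<alpha> - v y powr \<alpha>) / \<Lambda>)"
        using \<open>0 < \<Lambda>\<close> by (simp add: field_simps)
    qed
    have "1 * v y powr \<alpha> \<le> E y * H y powr \<alpha>"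
      using E H v_pos[of y] y \<open>0 < \<alpha>\<close> by (intro mult_mono powr_mono2) auto
    then have "0 \<le> F y * (E y * H y powr \<alpha> - v y powr \<alpha>) / \<Lambda>"
      using F_nonneg[of y] y \<open>0 < \<Lambda>\<close> by simp
    with D' show "\<exists>d. (D has_real_derivative d) (at y) \<and> d \<le> 0"
      by force
  next
    have "continuous_on {x..R} F" "continuous_on {x..R} v"
      using contF flux_form_continuous[OF flux] x by (auto intro: continuous_on_subset)
    then show "continuous_on {x..R} D"
      unfolding D_def H_def E_def using v_nonneg \<open>0 < \<alpha>\<close> \<open>0 < \<Lambda>\<close>
      by (intro continuous_intros continuous_on_powr') auto
  qed
  moreover have "D R = 0"
    using zero by (simp add: D_def H_def)
  ultimately show ?thesis
    by (simp add: D_def H_def E_def)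
qed

text \<open>With \<open>h = R\<close> and \<beta>, \<open>k\<close> close to 1 this bounds
  \<open>R\<close> by about \<open>c\<close>. The length \<open>h\<close> stays free because
  \<open>k\<close> deteriorates as \<open>h\<close> grows, while no bound on \<open>R\<close> is
  available yet.\<close>

lemma power_flux_growth:
  fixes \<Lambda> \<alpha> c h :: real
  defines "\<beta> \<equiv> (1 - \<alpha>) / (1 + \<alpha>)"
    and "k \<equiv> exp (- (c * \<alpha> * h / \<Lambda>)) * ((1 + \<alpha>) / (2 * \<Lambda>)) powr (\<alpha> / (1 + \<alpha>))"
  assumes flux: "flux_form \<Lambda> c R v F" and "0 < \<Lambda>"
    and F': "\<And>x. 0 < x \<Longrightarrow> x < R \<Longrightarrow> (F has_real_derivative - (v x powr \<alpha>)) (at x)"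
    and "0 < \<alpha>" "\<alpha> < 1" and v_pos: "\<And>x. 0 \<le> x \<Longrightarrow> x < R \<Longrightarrow> 0 < v x" and "v 0 \<le> 1"
    and h: "0 \<le> h" "h \<le> R"
  shows "\<beta> * k * h \<le> \<beta> * c + (1 - \<beta>)"
proof (cases "h = 0")
  case True
  have "0 < c" using flux by (auto simp: flux_form_def)
  with True \<open>0 < \<alpha>\<close> \<open>\<alpha> < 1\<close> show ?thesis
    by (simp add: \<beta>_def)
next
  case False
  with h have "0 < h" by simp
  have pos: "0 < c" "0 < R" and zero: "v R = 0" "F R = 0" "F 0 = c" and contF: "continuous_on {0..R} F"
    using flux by (auto simp: flux_form_def)
  have \<beta>: "0 < \<beta>" "\<beta> \<le> 1"
    using \<open>0 < \<alpha>\<close> \<open>\<alpha> < 1\<close> by (auto simp: \<beta>_def)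
  note bounds = power_flux_bounds[OF flux \<open>0 < \<Lambda>\<close> F' \<open>0 < \<alpha>\<close> less_imp_le[OF v_pos] \<open>v 0 \<le> 1\<close>]
  have F_nonneg: "0 \<le> F y" if "y \<in> {0..R}" for y
    using bounds(5)[of y] that by simp
  have F_pos: "0 < F y" if "0 \<le> y" "y < R" for y
  proof -
    have "0 < c * v y" using pos v_pos[OF that] by simp
    also have "\<dots> \<le> F y" using bounds(1)[of y] that by simp
    finally show ?thesis .
  qed
  \<comment> \<open>The energy inequality is raised to the power
    \<open>\<alpha> / (1 + \<alpha>)\<close>: \<open>H powr (1 + \<alpha>)\<close> becomes
    \<open>H powr \<alpha>\<close>, and the square of \<open>F\<close> gets exponent
    \<open>2 * \<alpha> / (1 + \<alpha>) = 1 - \<beta>\<close>. The first factor of \<open>k\<close>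
    absorbs the exponential in \<open>H\<close>, since \<open>R - y < h\<close>.\<close>
  have source: "k * F y powr (1 - \<beta>) \<le> v y powr \<alpha>" if y: "R - h < y" "y < R" for y
  proof -
    have "0 < y" using y h by linarith
    define H where "H = exp (c / \<Lambda> * (R - y)) * v y"
    have "0 < H" using v_pos[of y] y \<open>0 < y\<close> by (simp add: H_def)
    have "(F y)\<^sup>2 * ((1 + \<alpha>) / (2 * \<Lambda>)) \<le> H powr (1 + \<alpha>)"
      using power_flux_energy[OF flux \<open>0 < \<Lambda>\<close> F' \<open>0 < \<alpha>\<close> v_pos \<open>v 0 \<le> 1\<close>, of y] y \<open>0 < y\<close> \<open>0 < \<alpha>\<close>
      by (simp add: H_def field_simps)
    then have "((F y)\<^sup>2 * ((1 + \<alpha>) / (2 * \<Lambda>))) powr (\<alpha> / (1 + \<alpha>)) \<le> (H powr (1 + \<alpha>)) powr (\<alpha> / (1 + \<alpha>))"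
      using \<open>0 < \<alpha>\<close> \<open>0 < \<Lambda>\<close> by (intro powr_mono2) auto
    also have "(H powr (1 + \<alpha>)) powr (\<alpha> / (1 + \<alpha>)) = H powr \<alpha>"
      using \<open>0 < \<alpha>\<close> by (simp add: powr_powr)
    also have "((F y)\<^sup>2 * ((1 + \<alpha>) / (2 * \<Lambda>))) powr (\<alpha> / (1 + \<alpha>))
        = F y powr (1 - \<beta>) * ((1 + \<alpha>) / (2 * \<Lambda>)) powr (\<alpha> / (1 + \<alpha>))"
    proof -
      have "((F y)\<^sup>2) powr (\<alpha> / (1 + \<alpha>)) = (F y powr 2) powr (\<alpha> / (1 + \<alpha>))"
        using F_pos[of y] y \<open>0 < y\<close> by simp
      also have "\<dots> = F y powr (1 - \<beta>)"
        using \<open>0 < \<alpha>\<close> unfolding powr_powr \<beta>_def by (simp add: field_simps)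
      finally show ?thesis
        using \<open>0 < \<alpha>\<close> \<open>0 < \<Lambda>\<close> by (subst powr_mult) auto
    qed
    finally have *: "F y powr (1 - \<beta>) * ((1 + \<alpha>) / (2 * \<Lambda>)) powr (\<alpha> / (1 + \<alpha>)) \<le> H powr \<alpha>" .
    have "k * F y powr (1 - \<beta>) \<le> exp (- (c * \<alpha> * h / \<Lambda>)) * H powr \<alpha>"
      using * by (simp add: k_def mult_ac)
    also have "\<dots> = exp (- (c * \<alpha> * h / \<Lambda>)) * exp (c / \<Lambda> * (R - y)) powr \<alpha> * v y powr \<alpha>"
      using v_pos[of y] y \<open>0 < y\<close> by (simp add: H_def powr_mult)
    also have "exp (- (c * \<alpha> * h / \<Lambda>)) * exp (c / \<Lambda> * (R - y)) powr \<alpha> = exp (c * \<alpha> / \<Lambda> * ((R - y) - h))"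
      by (simp add: powr_def algebra_simps diff_divide_distrib add_divide_distrib flip: exp_add)
    also have "\<dots> * v y powr \<alpha> \<le> 1 * v y powr \<alpha>"
    proof (rule mult_right_mono)
      have "c * \<alpha> / \<Lambda> * ((R - y) - h) \<le> 0"
        using y pos \<open>0 < \<alpha>\<close> \<open>0 < \<Lambda>\<close> by (intro mult_nonneg_nonpos) auto
      then show "exp (c * \<alpha> / \<Lambda> * ((R - y) - h)) \<le> 1"
        by simp
    qed simp
    finally show ?thesis by simp
  qed
  \<comment> \<open>\<open>source\<close> says \<open>- F' \<ge> k F\<^sup>1\<^sup>-\<^sup>\<beta>\<close>, that is, \<open>- (F\<^sup>\<beta>)' \<ge> \<beta> k\<close>; Young's inequality then removes the
     exponent uniformly in \<open>F\<close>.\<close>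
  let ?P = "\<lambda>y. F y powr \<beta> + \<beta> * k * y"
  have "?P R \<le> ?P (R - h)"
  proof (rule DERIV_nonpos_imp_decreasing_open[of "R - h" R ?P])
    fix y assume y: "R - h < y" "y < R"
    then have y0: "0 < y" "y < R" using h by auto
    have Fy: "0 < F y" using F_pos y0 by simp
    have "(?P has_real_derivative \<beta> * F y powr (\<beta> - 1) * - (v y powr \<alpha>) + \<beta> * k) (at y)"
      using DERIV_add[OF DERIV_fun_powr[OF F'[OF y0] Fy, of \<beta>] DERIV_cmult_Id[of "\<beta> * k" y]] by simp
    moreover have "\<beta> * F y powr (\<beta> - 1) * - (v y powr \<alpha>) + \<beta> * k \<le> 0"
    proof -
      have "F y powr (\<beta> - 1) * (k * F y powr (1 - \<beta>)) \<le> F y powr (\<beta> - 1) * v y powr \<alpha>"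
        by (intro mult_left_mono source y) simp
      also have "F y powr (\<beta> - 1) * (k * F y powr (1 - \<beta>)) = k"
        using Fy by (simp add: mult.left_commute flip: powr_add)
      finally have "\<beta> * k \<le> \<beta> * (F y powr (\<beta> - 1) * v y powr \<alpha>)"
        using \<beta> by simp
      then show ?thesis
        by simp
    qed
    ultimately show "\<exists>d. (?P has_real_derivative d) (at y) \<and> d \<le> 0"
      by blast
  next
    show "continuous_on {R - h..R} ?P"
      using \<beta> h F_nonneg
      by (intro continuous_intros continuous_on_powr' continuous_on_subset[OF contF]) auto
  qed (use h in simp)
  \<comment> \<open>The trivial factor \<open>1 powr (1 - \<beta>)\<close> gives the product the
    shape required by the weighted Young inequality. That inequality is applied with
    \<open>F (R - h) > 0\<close>, which is why \<open>h = 0\<close> was treated separately.\<close>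
  then have "\<beta> * k * h \<le> F (R - h) powr \<beta> * 1 powr (1 - \<beta>)"
    using zero by (simp add: algebra_simps)
  also have "\<dots> \<le> \<beta> * F (R - h) + (1 - \<beta>) * 1"
    using \<beta> F_pos[of "R - h"] h \<open>0 < h\<close> by (intro Youngs_inequality_0) auto
  also have "F (R - h) \<le> c"
  proof -
    have "F (R - h) \<le> F 0"
    proof (rule DERIV_nonpos_imp_decreasing_open[of 0 "R - h" F])
      fix z assume "0 < z" "z < R - h"
      with h show "\<exists>d. (F has_real_derivative d) (at z) \<and> d \<le> 0"
        using F'[of z] by (intro exI conjI) auto
    qed (use h in \<open>auto intro: continuous_on_subset[OF contF]\<close>)
    with zero show ?thesis by simp
  qed
  finally show ?thesis
    using \<beta> by simp
qed

subsection \<open>Stability of the profiles and the limit system\<close>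

text \<open>Since \<open>v\<close> and \<open>F\<close> both vanish at \<open>R\<close>, the slope
  there is 0 as well. Gluing with zero therefore preserves the linear equation on the whole
  half-line, whatever the value of \<open>R\<close>.\<close>

lemma zero_ext_deriv:
  assumes flux: "flux_form \<Lambda> c R v F" and "0 \<le> x"
  shows "(zero_ext R v has_real_derivative (c * zero_ext R v x - zero_ext R F x) / \<Lambda>) (at x within {0..})"
proof -
  have pos: "0 < R" and zero: "v R = 0" "F R = 0"
    and v': "\<And>x. x \<in> {0..R} \<Longrightarrow> (v has_real_derivative (c * v x - F x) / \<Lambda>) (at x within {0..R})"
    using flux by (auto simp: flux_form_def)
  have UN: "{0..R} \<union> {R..} = {0..}"
    using pos by auto
  have INT: "{0..R} \<inter> {R..} = {R}"
    using pos by auto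
  have "((\<lambda>x. if x \<in> {0..R} then v x else 0) has_vector_derivative
      (if x \<in> {0..R} then (c * v x - F x) / \<Lambda> else 0)) (at x within {0..})"
  proof (rule has_vector_derivative_If_within_closures[where T = "{R..}"])
    show "(v has_vector_derivative (c * v x - F x) / \<Lambda>)
        (at x within {0..R} \<union> closure {0..R} \<inter> closure {R..})"
      if "x \<in> {0..R} \<union> closure {0..R} \<inter> closure {R..}"
      using v'[of x] that pos INT
      by (simp add: has_real_derivative_iff_has_vector_derivative insert_absorb Un_absorb2)
  qed (use UN zero \<open>0 \<le> x\<close> pos in auto)
  then have "(zero_ext R v has_vector_derivative
      (if x \<in> {0..R} then (c * v x - F x) / \<Lambda> else 0)) (at x within {0..})"
    by (rule has_vector_derivative_transform[rotated -1]) (use \<open>0 \<le> x\<close> in \<open>auto simp: zero_ext_def\<close>)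
  then show ?thesis
    using \<open>0 \<le> x\<close> by (auto simp: zero_ext_def has_real_derivative_iff_has_vector_derivative split: if_splits)
qed

lemma zero_ext_vector_derivative:
  assumes "flux_form \<Lambda> c R v F" "0 \<le> x"
  shows "vector_derivative (zero_ext R v) (at x within {0..}) =
    (c * zero_ext R v x - zero_ext R F x) / \<Lambda>"
proof (rule vector_derivative_within)
  have "x islimpt {0..x + 1}"
    using \<open>0 \<le> x\<close> by simp
  then have "x islimpt {0..}"
    by (rule islimpt_subset) auto
  then show "at x within {0..} \<noteq> bot"
    by (simp add: trivial_limit_within)
  show "(zero_ext R v has_vector_derivative (c * zero_ext R v x - zero_ext R F x) / \<Lambda>) (at x within {0..})"
    using zero_ext_deriv[OF assms] by (simp add: has_real_derivative_iff_has_vector_derivative)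
qed

text \<open>Here \<open>v'\<close> and \<open>F'\<close> are a second profile and flux, not
  derivatives. The difference of the extensions solves a backward equation with rate
  \<open>c / \<Lambda>\<close>, whose source \<open>e\<close> collects the flux difference and the
  speed difference; \<open>\<bar>v'\<bar> \<le> 1\<close> controls the latter.\<close>

lemma flux_form_stability:
  assumes flux: "flux_form \<Lambda> c R v F" and flux': "flux_form \<Lambda> c' R' v' F'" and "0 < \<Lambda>"
    and v'_le: "\<And>x. x \<in> {0..R'} \<Longrightarrow> \<bar>v' x\<bar> \<le> 1"
    and \<delta>: "\<And>x. 0 \<le> x \<Longrightarrow> \<bar>zero_ext R F x - zero_ext R' F' x\<bar> \<le> \<delta>"
    and "0 \<le> x"
  shows "\<bar>zero_ext R v x - zero_ext R' v' x\<bar> \<le> (\<delta> + \<bar>c - c'\<bar>) / c"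
    and "\<bar>vector_derivative (zero_ext R v) (at x within {0..})
      - vector_derivative (zero_ext R' v') (at x within {0..})\<bar> \<le> 2 * (\<delta> + \<bar>c - c'\<bar>) / \<Lambda>"
proof -
  define z where "z = zero_ext R v"
  define z' where "z' = zero_ext R' v'"
  define e where "e = (\<lambda>x. (zero_ext R F x - zero_ext R' F' x - (c - c') * z' x) / \<Lambda>)"
  have "0 < c" using flux by (simp add: flux_form_def)
  have "\<bar>zero_ext R F 0 - zero_ext R' F' 0\<bar> \<le> \<delta>" by (rule \<delta>) simp
  then have "0 \<le> \<delta>" by linarith
  have dz: "((\<lambda>x. z x - z' x) has_real_derivative c / \<Lambda> * (z y - z' y) - e y) (at y within {0..})"
    if "0 \<le> y" for y
    using zero_ext_deriv[OF flux that] zero_ext_deriv[OF flux' that] \<open>0 < \<Lambda>\<close>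
    unfolding z_def z'_def e_def
    by (auto intro!: derivative_eq_intros simp: field_simps)
  have e: "\<bar>e y\<bar> \<le> (\<delta> + \<bar>c - c'\<bar>) / \<Lambda>" if "0 \<le> y" for y
  proof -
    have "\<bar>z' y\<bar> \<le> 1"
      using v'_le[of y] that by (auto simp: z'_def zero_ext_def)
    then have "\<bar>(c - c') * z' y\<bar> \<le> \<bar>c - c'\<bar> * 1"
      unfolding abs_mult by (intro mult_left_mono) auto
    with \<delta>[OF that]
    have "\<bar>zero_ext R F y - zero_ext R' F' y - (c - c') * z' y\<bar> \<le> \<delta> + \<bar>c - c'\<bar> * 1"
      by (intro order.trans[OF abs_triangle_ineq4 add_mono])
    with \<open>0 < \<Lambda>\<close> show ?thesis
      by (simp add: e_def divide_right_mono)
  qed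
  \<comment> \<open>This point lies to the right of \<open>x\<close> and of both free boundaries, so
    both extensions vanish there.\<close>
  define b where "b = max x (max R R') + 1"
  have "\<bar>z x - z' x\<bar> \<le> (\<delta> + \<bar>c - c'\<bar>) / \<Lambda> / (c / \<Lambda>)"
  proof (rule backward_bound[where d = "\<lambda>x. z x - z' x" and e = e])
    show "x \<le> b" "z b - z' b = 0"
      by (auto simp: b_def z_def z'_def zero_ext_def)
    have "continuous_on {0..} (\<lambda>x. z x - z' x)"
      using dz by (intro DERIV_continuous_on) auto
    then show "continuous_on {x..b} (\<lambda>x. z x - z' x)"
      by (rule continuous_on_subset) (use \<open>0 \<le> x\<close> in auto)
    show "((\<lambda>x. z x - z' x) has_real_derivative c / \<Lambda> * (z y - z' y) - e y) (at y)"
      if "x < y" "y < b" for y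
    proof -
      have "at y within {0..} = at y"
        using that \<open>0 \<le> x\<close> by (intro at_within_interior) (auto simp: interior_Ici)
      with dz[of y] that \<open>0 \<le> x\<close> show ?thesis by simp
    qed
  qed (use e \<open>0 \<le> \<delta>\<close> \<open>0 < \<Lambda>\<close> \<open>0 < c\<close> \<open>0 \<le> x\<close> in auto)
  then have d: "\<bar>z x - z' x\<bar> \<le> (\<delta> + \<bar>c - c'\<bar>) / c"
    using \<open>0 < \<Lambda>\<close> by simp
  then show "\<bar>zero_ext R v x - zero_ext R' v' x\<bar> \<le> (\<delta> + \<bar>c - c'\<bar>) / c"
    by (simp add: z_def z'_def)
  \<comment> \<open>The derivatives differ by \<open>c / \<Lambda> * (z x - z' x) - e x\<close>;
    each term is at most \<open>(\<delta> + \<bar>c - c'\<bar>) / \<Lambda>\<close>, which explains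
    the factor 2.\<close>
  have "\<bar>c / \<Lambda> * (z x - z' x)\<bar> = c / \<Lambda> * \<bar>z x - z' x\<bar>"
    using \<open>0 < c\<close> \<open>0 < \<Lambda>\<close> by (simp add: abs_mult)
  also have "\<dots> \<le> c / \<Lambda> * ((\<delta> + \<bar>c - c'\<bar>) / c)"
    using d \<open>0 < c\<close> \<open>0 < \<Lambda>\<close> by (intro mult_left_mono) auto
  also have "\<dots> = (\<delta> + \<bar>c - c'\<bar>) / \<Lambda>"
    using \<open>0 < c\<close> by simp
  finally have "\<bar>c / \<Lambda> * (z x - z' x) - e x\<bar> \<le> (\<delta> + \<bar>c - c'\<bar>) / \<Lambda> + (\<delta> + \<bar>c - c'\<bar>) / \<Lambda>"
    using e[OF \<open>0 \<le> x\<close>] by (intro order.trans[OF abs_triangle_ineq4 add_mono])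
  then have "\<bar>c / \<Lambda> * (z x - z' x) - e x\<bar> \<le> 2 * (\<delta> + \<bar>c - c'\<bar>) / \<Lambda>"
    by (simp add: field_simps)
  moreover have "vector_derivative (zero_ext R v) (at x within {0..})
      - vector_derivative (zero_ext R' v') (at x within {0..}) = c / \<Lambda> * (z x - z' x) - e x"
    unfolding zero_ext_vector_derivative[OF flux \<open>0 \<le> x\<close>] zero_ext_vector_derivative[OF flux' \<open>0 \<le> x\<close>]
      z_def z'_def e_def
    using \<open>0 < \<Lambda>\<close> by (simp add: field_simps)
  ultimately show "\<bar>vector_derivative (zero_ext R v) (at x within {0..})
      - vector_derivative (zero_ext R' v') (at x within {0..})\<bar> \<le> 2 * (\<delta> + \<bar>c - c'\<bar>) / \<Lambda>"
    by simp
qed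

text \<open>The solution of \<open>\<Lambda> * v' = c * v - (c - x)\<close> that vanishes at
  \<open>x = c\<close>.\<close>

definition limit_profile :: "real \<Rightarrow> real \<Rightarrow> real \<Rightarrow> real" where
  "limit_profile \<Lambda> c x = (c - x) / c - \<Lambda> / c\<^sup>2 * (1 - exp (- (c * (c - x) / \<Lambda>)))"

lemma limit_profile_deriv:
  assumes "0 < \<Lambda>" "0 < c"
  shows "(limit_profile \<Lambda> c has_real_derivative - (1 - exp (- (c * (c - x) / \<Lambda>))) / c) (at x within S)"
  using assms unfolding limit_profile_def[abs_def]
  by (auto intro!: derivative_eq_intros simp: field_simps power2_eq_square)

lemma flux_form_limit_profile:
  assumes "0 < \<Lambda>" "0 < c"
  shows "flux_form \<Lambda> c c (limit_profile \<Lambda> c) (\<lambda>x. c - x)"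
proof -
  have "(limit_profile \<Lambda> c has_real_derivative (c * limit_profile \<Lambda> c x - (c - x)) / \<Lambda>)
      (at x within {0..c})" for x
  proof -
    have "- (1 - exp (- (c * (c - x) / \<Lambda>))) / c = (c * limit_profile \<Lambda> c x - (c - x)) / \<Lambda>"
      using assms by (simp add: limit_profile_def field_simps power2_eq_square)
    with limit_profile_deriv[OF assms] show ?thesis
      by metis
  qed
  then show ?thesis
    using assms by (auto simp: flux_form_def limit_profile_def intro!: continuous_intros)
qed

lemma limit_profile_pos:
  assumes "0 < \<Lambda>" "0 < c" "x < c"
  shows "0 < limit_profile \<Lambda> c x"
proof -
  let ?y = "c * (c - x) / \<Lambda>"
  have "limit_profile \<Lambda> c x = \<Lambda> / c\<^sup>2 * (exp (- ?y) - (1 - ?y))"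
    using assms by (simp add: limit_profile_def field_simps power2_eq_square)
  moreover have "1 - ?y < exp (- ?y)"
    using assms by (subst exp_minus_greater) auto
  ultimately show ?thesis
    using assms by simp
qed

lemma limit_profile_abs_le_1:
  assumes "0 < \<Lambda>" "0 < c" "x \<in> {0..c}"
  shows "\<bar>limit_profile \<Lambda> c x\<bar> \<le> 1"
proof -
  have "0 \<le> limit_profile \<Lambda> c x"
    using limit_profile_pos[OF assms(1,2), of x] assms
    by (cases "x = c") (auto simp: limit_profile_def)
  moreover have "limit_profile \<Lambda> c x \<le> (c - x) / c"
    using assms by (simp add: limit_profile_def)
  moreover have "(c - x) / c \<le> 1"
    using assms by simp
  ultimately show ?thesis
    by simp
qed

text \<open>Membership of the initial value in \<open>I_set\<close> is a hypothesis here; it is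
  obtained later as a limit of the initial values \<open>v n 0\<close>.\<close>

lemma fb_solution_limit_profile:
  assumes "0 < \<Lambda>" "0 < c" and c: "exp_avg (c\<^sup>2) = \<theta>" and I: "limit_profile \<Lambda> c 0 \<in> I_set \<Lambda> \<theta>"
  shows "fb_solution \<Lambda> \<theta> (\<lambda>_. 1) c c (limit_profile \<Lambda> c)"
proof -
  let ?V = "limit_profile \<Lambda> c"
  let ?V' = "\<lambda>x. - (1 - exp (- (c * (c - x) / \<Lambda>))) / c"
  let ?V'' = "\<lambda>x. exp (- (c * (c - x) / \<Lambda>)) / \<Lambda>"
  note flux = flux_form_limit_profile[OF assms(1,2)]
  note V' = limit_profile_deriv[OF assms(1,2)]
  have V'': "(?V' has_real_derivative ?V'' x) (at x)" for x
    using assms by (auto intro!: derivative_eq_intros simp: field_simps)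
  have dV: "deriv ?V = ?V'"
    using V' by (auto intro!: DERIV_imp_deriv)
  have dV': "deriv ?V' = ?V''"
    using V'' by (auto intro!: DERIV_imp_deriv)
  have ode: "\<Lambda> * deriv (deriv ?V) x - c * deriv ?V x = 1" for x
    unfolding dV dV' using assms by simp
  \<comment> \<open>Closed form of all derivatives: each differentiation multiplies the exponential
    term by \<open>c / \<Lambda>\<close>, while the affine part survives only for
    \<open>k = 0\<close> and \<open>k = 1\<close>.\<close>
  define D :: "nat \<Rightarrow> real \<Rightarrow> real" where
    "D k x = (if k = 0 then (c - x) / c - \<Lambda> / c\<^sup>2 else if k = 1 then - 1 / c else 0)
      + \<Lambda> / c\<^sup>2 * (c / \<Lambda>) ^ k * exp (- (c * (c - x) / \<Lambda>))" for k x
  have "(D k has_real_derivative D (Suc k) x) (at x within S)" for k x S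
    using assms unfolding D_def[abs_def]
    by (cases k) (auto intro!: derivative_eq_intros simp: field_simps)
  moreover have "D 0 x = ?V x" for x
    by (simp add: D_def limit_profile_def algebra_simps)
  ultimately have "C_inf_on {0..<c} ?V"
    unfolding C_inf_on_def by blast
  moreover have "C1_on {0..c} ?V"
    unfolding C1_on_def using assms
    by (intro exI[of _ ?V'] conjI ballI V') (auto intro!: continuous_intros)
  moreover have "(?V has_real_derivative - (c / \<Lambda>) * (1 - ?V 0)) (at 0 within {0..c})"
  proof -
    have "- (c / \<Lambda>) * (1 - ?V 0) = ?V' 0"
      using assms by (simp add: limit_profile_def field_simps power2_eq_square)
    with V' show ?thesis
      by metis
  qed
  moreover have "(?V has_real_derivative 0) (at c within {0..c})"
    using V'[of c "{0..c}"] by simp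
  \<comment> \<open>The weighted integral of the flux \<open>c - s\<close> is computed in two ways;
    equating the values gives the integral condition.\<close>
  moreover have "\<theta> + \<Lambda> * ?V 0 = 1 - c * (1 - \<Lambda>) * integral {0..c} (\<lambda>s. exp (- c * s) * ?V s)"
    using has_integral_unique[OF flux_form_has_integral[OF flux \<open>0 < \<Lambda>\<close>]
        has_integral_exp_linear_diag[OF \<open>0 < c\<close>]] c by simp
  ultimately show ?thesis
    unfolding fb_solution_def using assms ode I
    by (auto simp: limit_profile_def[of _ _ c])
qed

text \<open>A constant reaction term makes the flux affine, so \<open>F x = R - x\<close> and
  \<open>F 0 = c\<close> forces \<open>R = c\<close>. The integral condition and strict monotonicity
  of \<open>exp_avg\<close> fix \<open>c\<close>; stability with zero flux and speed differences
  then fixes the profile.\<close>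

lemma limit_fb_solution_unique:
  assumes "0 < \<Lambda>" "0 < c\<^sub>0" and c\<^sub>0: "exp_avg (c\<^sub>0\<^sup>2) = \<theta>"
    and sol: "fb_solution \<Lambda> \<theta> (\<lambda>_. 1) c R v"
  shows "c = c\<^sub>0" "R = c\<^sub>0" "\<And>x. x \<in> {0..c\<^sub>0} \<Longrightarrow> v x = limit_profile \<Lambda> c\<^sub>0 x"
proof -
  obtain F where flux: "flux_form \<Lambda> c R v F"
    and F': "\<And>x. 0 < x \<Longrightarrow> x < R \<Longrightarrow> (F has_real_derivative - 1) (at x)"
    and int: "((\<lambda>s. exp (- c * s) * F s) has_integral 1 - \<theta>) {0..R}"
    using fb_solution_flux_form[OF \<open>0 < \<Lambda>\<close> sol] by blast
  have pos: "0 < c" "0 < R" and zero: "F R = 0" "F 0 = c" and contF: "continuous_on {0..R} F"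
    using flux by (auto simp: flux_form_def)
  have F_eq: "F x = R - x" if "x \<in> {0..R}" for x
  proof (cases "x = R")
    case False
    have "F R + R = F x + x"
    proof (rule DERIV_isconst_end[of x R "\<lambda>x. F x + x"])
      show "continuous_on {x..R} (\<lambda>x. F x + x)"
        by (intro continuous_intros continuous_on_subset[OF contF]) (use that in auto)
      show "((\<lambda>x. F x + x) has_real_derivative 0) (at y)" if "x < y" "y < R" for y
        using F'[of y] that \<open>x \<in> {0..R}\<close> by (auto intro!: derivative_eq_intros)
    qed (use False that in auto)
    with zero show ?thesis by simp
  qed (use zero in simp)
  have "R = c" using F_eq[of 0] zero pos by simp
  have "((\<lambda>s. exp (- c * s) * (c - s)) has_integral 1 - \<theta>) {0..c}"
    by (rule has_integral_eq[OF _ int[unfolded \<open>R = c\<close>]]) (simp add: F_eq \<open>R = c\<close>)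
  from has_integral_unique[OF this has_integral_exp_linear_diag[OF pos(1)]]
  have "exp_avg (c\<^sup>2) = exp_avg (c\<^sub>0\<^sup>2)"
    using c\<^sub>0 by simp
  then show "c = c\<^sub>0"
    using exp_avg_strict_antimono[of "c\<^sup>2" "c\<^sub>0\<^sup>2"] exp_avg_strict_antimono[of "c\<^sub>0\<^sup>2" "c\<^sup>2"] pos \<open>0 < c\<^sub>0\<close>
    by (metis less_irrefl linorder_neqE_linordered_idom power_strict_mono pos2 less_imp_le zero_less_power)
  with \<open>R = c\<close> show "R = c\<^sub>0" by simp
  fix x assume x: "x \<in> {0..c\<^sub>0}"
  have "\<bar>zero_ext c\<^sub>0 v x - zero_ext c\<^sub>0 (limit_profile \<Lambda> c\<^sub>0) x\<bar> \<le> (0 + \<bar>c\<^sub>0 - c\<^sub>0\<bar>) / c\<^sub>0"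
    using flux[unfolded \<open>R = c\<^sub>0\<close> \<open>c = c\<^sub>0\<close>] flux_form_limit_profile[OF \<open>0 < \<Lambda>\<close> \<open>0 < c\<^sub>0\<close>] \<open>0 < \<Lambda>\<close>
  proof (rule flux_form_stability)
    show "\<bar>zero_ext c\<^sub>0 F y - zero_ext c\<^sub>0 (\<lambda>x. c\<^sub>0 - x) y\<bar> \<le> 0" if "0 \<le> y" for y
      using F_eq[of y] that \<open>R = c\<^sub>0\<close> by (simp add: zero_ext_def)
  qed (use x limit_profile_abs_le_1[OF assms(1,2)] in auto)
  then show "v x = limit_profile \<Lambda> c\<^sub>0 x"
    using x by (simp add: zero_ext_def)
qed

subsection \<open>Passage to the limit\<close>

lemma growth_constant_tendsto:
  fixes \<alpha> :: "nat \<Rightarrow> real"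
  assumes "0 < \<Lambda>" "\<alpha> \<longlonglongrightarrow> 0"
  shows "(\<lambda>n. (1 - \<alpha> n) / (1 + \<alpha> n)) \<longlonglongrightarrow> 1"
    and "(\<lambda>n. exp (- (K * \<alpha> n)) * ((1 + \<alpha> n) / (2 * \<Lambda>)) powr (\<alpha> n / (1 + \<alpha> n))) \<longlonglongrightarrow> 1"
proof -
  have "(\<lambda>n. (1 - \<alpha> n) / (1 + \<alpha> n)) \<longlonglongrightarrow> (1 - 0) / (1 + 0)"
    by (intro tendsto_intros assms) simp
  then show "(\<lambda>n. (1 - \<alpha> n) / (1 + \<alpha> n)) \<longlonglongrightarrow> 1"
    by simp
  have "(\<lambda>n. exp (- (K * \<alpha> n)) * ((1 + \<alpha> n) / (2 * \<Lambda>)) powr (\<alpha> n / (1 + \<alpha> n)))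
      \<longlonglongrightarrow> exp (- (K * 0)) * ((1 + 0) / (2 * \<Lambda>)) powr (0 / (1 + 0))"
    by (intro tendsto_intros assms) (use \<open>0 < \<Lambda>\<close> in auto)
  then show "(\<lambda>n. exp (- (K * \<alpha> n)) * ((1 + \<alpha> n) / (2 * \<Lambda>)) powr (\<alpha> n / (1 + \<alpha> n))) \<longlonglongrightarrow> 1"
    using \<open>0 < \<Lambda>\<close> by simp
qed

text \<open>As \<open>R n\<close> is not yet known to be bounded, the growth inequality is used at
  the truncated length \<open>h n = min (R n) T\<close>. It yields
  \<open>h n - c n \<le> \<epsilon> n\<close> with \<open>\<epsilon> n\<close> tending to 0.\<close>

lemma width_diff_tendsto_zero:
  fixes \<alpha> c R :: "nat \<Rightarrow> real"
  assumes "0 < \<Lambda>" and \<alpha>: "\<And>n. 0 < \<alpha> n" "\<And>n. \<alpha> n < 1" "\<alpha> \<longlonglongrightarrow> 0"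
    and c: "\<And>n. 0 < c n" "\<And>n. c n \<le> R n" "\<And>n. c n \<le> c\<^sub>0"
    and growth: "\<And>n h. 0 \<le> h \<Longrightarrow> h \<le> R n \<Longrightarrow>
      (1 - \<alpha> n) / (1 + \<alpha> n) *
        (exp (- (c n * \<alpha> n * h / \<Lambda>)) * ((1 + \<alpha> n) / (2 * \<Lambda>)) powr (\<alpha> n / (1 + \<alpha> n))) * h
      \<le> (1 - \<alpha> n) / (1 + \<alpha> n) * c n + (1 - (1 - \<alpha> n) / (1 + \<alpha> n))"
  shows "(\<lambda>n. R n - c n) \<longlonglongrightarrow> 0" and "eventually (\<lambda>n. R n \<le> c\<^sub>0 + 1) sequentially"
proof -
  define T where "T = c\<^sub>0 + 1"
  define \<beta> where "\<beta> = (\<lambda>n. (1 - \<alpha> n) / (1 + \<alpha> n))"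
  define q where "q = (\<lambda>n. ((1 + \<alpha> n) / (2 * \<Lambda>)) powr (\<alpha> n / (1 + \<alpha> n)))"
  \<comment> \<open>In the exponent \<open>c n\<close> and \<open>h n\<close> are replaced by their
    upper bounds \<open>c\<^sub>0\<close> and \<open>T\<close>. The constant only gets smaller and
    depends on \<open>n\<close> through \<open>\<alpha> n\<close> alone.\<close>
  define k where "k = (\<lambda>n. exp (- (c\<^sub>0 * T / \<Lambda> * \<alpha> n)) * q n)"
  define \<epsilon> where "\<epsilon> = (\<lambda>n. T * \<bar>1 - \<beta> n * k n\<bar> + (1 - \<beta> n))"
  define h where "h = (\<lambda>n. min (R n) T)"
  have c\<^sub>0: "0 < c\<^sub>0" using c(1,3)[of 0] by linarith
  have R: "0 < R n" for n using c(1,2)[of n] by linarith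
  have lim: "\<beta> \<longlonglongrightarrow> 1" "k \<longlonglongrightarrow> 1"
    using growth_constant_tendsto(1)[OF \<open>0 < \<Lambda>\<close> \<alpha>(3)]
      growth_constant_tendsto(2)[OF \<open>0 < \<Lambda>\<close> \<alpha>(3), of "c\<^sub>0 * T / \<Lambda>"]
    unfolding \<beta>_def k_def q_def .
  have "\<epsilon> \<longlonglongrightarrow> T * \<bar>1 - 1 * 1\<bar> + (1 - 1)"
    unfolding \<epsilon>_def by (intro tendsto_intros lim)
  then have \<epsilon>: "\<epsilon> \<longlonglongrightarrow> 0" by simp
  have gap: "h n - c n \<le> \<epsilon> n" for n
  proof -
    have \<beta>: "0 < \<beta> n" "\<beta> n \<le> 1"
      using \<alpha>(1,2)[of n] by (auto simp: \<beta>_def)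
    have h: "0 < h n" "h n \<le> R n" "h n \<le> T"
      using R[of n] c\<^sub>0 by (auto simp: h_def T_def)
    have "c n * h n \<le> c\<^sub>0 * T"
      using c[of n] h c\<^sub>0 by (intro mult_mono) auto
    then have "c n * \<alpha> n * h n / \<Lambda> \<le> c\<^sub>0 * T / \<Lambda> * \<alpha> n"
      using \<alpha>(1)[of n] \<open>0 < \<Lambda>\<close> by (simp add: divide_right_mono mult.commute mult.left_commute)
    then have "k n \<le> exp (- (c n * \<alpha> n * h n / \<Lambda>)) * q n"
      unfolding k_def by (intro mult_right_mono) (auto simp: q_def)
    then have "\<beta> n * k n * h n \<le> \<beta> n * (exp (- (c n * \<alpha> n * h n / \<Lambda>)) * q n) * h n"
      using \<beta> h by (intro mult_right_mono mult_left_mono) auto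
    also have "\<dots> \<le> \<beta> n * c n + (1 - \<beta> n)"
      using growth[of "h n" n] h unfolding \<beta>_def q_def by simp
    also have "\<beta> n * c n \<le> c n"
      using \<beta> c(1)[of n] by simp
    finally have "\<beta> n * k n * h n \<le> c n + (1 - \<beta> n)"
      by simp
    moreover have "h n * (1 - \<beta> n * k n) \<le> T * \<bar>1 - \<beta> n * k n\<bar>"
      using h by (intro order.trans[OF mult_left_mono[OF abs_ge_self] mult_right_mono]) auto
    ultimately show ?thesis
      by (simp add: \<epsilon>_def algebra_simps)
  qed
  have "eventually (\<lambda>n. \<epsilon> n < 1) sequentially"
    using \<epsilon> by (rule order_tendstoD) simp
  \<comment> \<open>Once \<open>\<epsilon> n < 1\<close>, the gap estimate gives
    \<open>h n < c\<^sub>0 + 1 = T\<close>, so the minimum is attained by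
    \<open>R n\<close>.\<close>
  then have ev: "eventually (\<lambda>n. h n = R n) sequentially"
  proof eventually_elim
    case (elim n)
    then show ?case
      using gap[of n] c(3)[of n] by (auto simp: h_def T_def)
  qed
  then show "eventually (\<lambda>n. R n \<le> c\<^sub>0 + 1) sequentially"
    by eventually_elim (auto simp: h_def T_def)
  show "(\<lambda>n. R n - c n) \<longlonglongrightarrow> 0"
  proof (rule tendsto_sandwich[OF _ _ tendsto_const \<epsilon>])
    show "eventually (\<lambda>n. 0 \<le> R n - c n) sequentially"
      using c(2) by simp
    show "eventually (\<lambda>n. R n - c n \<le> \<epsilon> n) sequentially"
      using ev by eventually_elim (use gap in metis)
  qed
qed

text \<open>Only a lower bound is at stake. If \<open>c n \<le> a < c\<^sub>0\<close>, then
  \<open>exp_avg ((c n)\<^sup>2)\<close> is at least \<open>exp_avg (a\<^sup>2)\<close>, which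
  exceeds \<open>exp_avg (c\<^sub>0\<^sup>2)\<close> by a fixed amount, whereas the error
  \<open>(R n - c n) * R n\<close> tends to 0.\<close>

lemma speed_tendsto:
  fixes c R :: "nat \<Rightarrow> real"
  assumes c: "\<And>n. 0 < c n" "\<And>n. c n \<le> R n" "\<And>n. c n \<le> c\<^sub>0"
    and diff: "(\<lambda>n. R n - c n) \<longlonglongrightarrow> 0" and R: "eventually (\<lambda>n. R n \<le> T) sequentially"
    and avg: "\<And>n. exp_avg ((c n)\<^sup>2) \<le> exp_avg (c\<^sub>0\<^sup>2) + (R n - c n) * R n"
  shows "c \<longlonglongrightarrow> c\<^sub>0"
proof (rule order_tendstoI)
  fix a assume "a < c\<^sub>0"
  show "eventually (\<lambda>n. a < c n) sequentially"
  proof (cases "0 < a")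
    case False
    with c(1) show ?thesis
      by (intro always_eventually allI) (meson less_le_trans not_less le_less_trans)
  next
    case True
    with \<open>a < c\<^sub>0\<close> have less: "exp_avg (c\<^sub>0\<^sup>2) < exp_avg (a\<^sup>2)"
      by (intro exp_avg_strict_antimono) (auto intro: power_strict_mono)
    have "(\<lambda>n. exp_avg (c\<^sub>0\<^sup>2) + (R n - c n) * T) \<longlonglongrightarrow> exp_avg (c\<^sub>0\<^sup>2) + 0 * T"
      by (intro tendsto_intros diff)
    then have "eventually (\<lambda>n. exp_avg (c\<^sub>0\<^sup>2) + (R n - c n) * T < exp_avg (a\<^sup>2)) sequentially"
      using less by (intro order_tendstoD) auto
    with R show ?thesis
    proof eventually_elim
      case (elim n)
      have "(R n - c n) * R n \<le> (R n - c n) * T"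
        using c(2)[of n] elim by (intro mult_left_mono) auto
      with elim avg[of n] have *: "exp_avg ((c n)\<^sup>2) < exp_avg (a\<^sup>2)"
        by linarith
      show ?case
      proof (rule ccontr)
        assume "\<not> a < c n"
        then consider "c n = a" | "c n < a" by linarith
        then show False
        proof cases
          case 2
          then have "exp_avg (a\<^sup>2) < exp_avg ((c n)\<^sup>2)"
            using c(1)[of n] by (intro exp_avg_strict_antimono) (auto intro: power_strict_mono less_imp_le)
          with * show False by simp
        qed (use * in simp)
      qed
    qed
  qed
next
  fix a assume "c\<^sub>0 < a"
  with c(3) show "eventually (\<lambda>n. c n < a) sequentially"
    by (intro always_eventually allI) (meson le_less_trans)
qed

lemma uniform_limit_dominated:
  fixes f :: "nat \<Rightarrow> 'a \<Rightarrow> real"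
  assumes "\<And>n x. x \<in> S \<Longrightarrow> \<bar>f n x - g x\<bar> \<le> b n" and "b \<longlonglongrightarrow> 0"
  shows "uniform_limit S f g sequentially"
proof (rule uniform_limitI)
  fix e :: real assume "0 < e"
  then have "eventually (\<lambda>n. b n < e) sequentially"
    using assms(2) by (intro order_tendstoD)
  then show "eventually (\<lambda>n. \<forall>x\<in>S. dist (f n x) (g x) < e) sequentially"
    by eventually_elim (auto simp: dist_real_def intro: le_less_trans assms(1))
qed

lemma I_set_le_1: "0 < \<Lambda> \<Longrightarrow> 0 < \<theta> \<Longrightarrow> x \<in> I_set \<Lambda> \<theta> \<Longrightarrow> x \<le> 1"
  by (auto simp: I_set_def split: if_splits elim!: order.trans)

lemma closed_I_set: "closed (I_set \<Lambda> \<theta>)"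
  by (simp add: I_set_def)

text \<open>Pass through the positive part of \<open>R - x\<close>: the extended flux is within
  \<open>R - c\<close> of it, and the positive parts of \<open>R - x\<close> and
  \<open>c\<^sub>0 - x\<close> differ by at most \<open>\<bar>R - c\<^sub>0\<bar>\<close>.\<close>

lemma flux_diff_bound:
  assumes "0 \<le> x"
    and "\<And>x. x \<in> {0..R} \<Longrightarrow> c - x \<le> F x"
    and "\<And>x. x \<in> {0..R} \<Longrightarrow> F x \<le> R - x"
    and "\<And>x. x \<in> {0..R} \<Longrightarrow> 0 \<le> F x" and "c \<le> R"
  shows "\<bar>zero_ext R F x - zero_ext c\<^sub>0 (\<lambda>x. c\<^sub>0 - x) x\<bar> \<le> (R - c) + \<bar>R - c\<^sub>0\<bar>"
proof (cases "x \<le> R")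
  case True
  then have "c - x \<le> F x" "F x \<le> R - x" "0 \<le> F x"
    using assms by auto
  with True \<open>c \<le> R\<close> show ?thesis
    unfolding zero_ext_def by (auto simp: abs_le_iff)
next
  case False
  with \<open>c \<le> R\<close> show ?thesis
    unfolding zero_ext_def by auto
qed

theorem lemma8p4:
  fixes \<Lambda> \<theta> :: real
    and \<alpha> c R :: "nat \<Rightarrow> real"
    and v :: "nat \<Rightarrow> real \<Rightarrow> real"
  assumes "0 < \<Lambda>" and "0 < \<theta>" and "\<theta> < 1"
    and "decseq \<alpha>" and "\<And>n. 0 < \<alpha> n" and "\<And>n. \<alpha> n < 1" and "\<alpha> \<longlonglongrightarrow> 0"
    and "\<And>n. fb_solution \<Lambda> \<theta> (\<lambda>u. u powr \<alpha> n) (c n) (R n) (v n)"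
    and "\<And>n \<xi>. 0 \<le> \<xi> \<Longrightarrow> \<xi> < R n \<Longrightarrow> 0 < v n \<xi>"
  shows "\<exists>c\<^sub>0 R\<^sub>0 v\<^sub>0.
      fb_solution \<Lambda> \<theta> (\<lambda>_. 1) c\<^sub>0 R\<^sub>0 v\<^sub>0 \<and> (\<forall>\<xi>\<in>{0..<R\<^sub>0}. 0 < v\<^sub>0 \<xi>) \<and>
      (\<forall>c\<^sub>1 R\<^sub>1 v\<^sub>1. fb_solution \<Lambda> \<theta> (\<lambda>_. 1) c\<^sub>1 R\<^sub>1 v\<^sub>1 \<longrightarrow>
         c\<^sub>1 = c\<^sub>0 \<and> R\<^sub>1 = R\<^sub>0 \<and> (\<forall>\<xi>\<in>{0..R\<^sub>0}. v\<^sub>1 \<xi> = v\<^sub>0 \<xi>)) \<and>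
      c\<^sub>0 = R\<^sub>0 \<and>
      (\<forall>x::real. (0 < x \<and> exp (x\<^sup>2) = 1 / (1 - x\<^sup>2 * \<theta>)) \<longleftrightarrow> x = c\<^sub>0) \<and>
      c \<longlonglongrightarrow> c\<^sub>0 \<and> R \<longlonglongrightarrow> R\<^sub>0 \<and> profiles_converge R v R\<^sub>0 v\<^sub>0"
proof -
  note \<Lambda> = \<open>0 < \<Lambda>\<close> and sol = assms(8) and v_pos = assms(9)
  obtain x\<^sub>0 where "0 < x\<^sub>0" "exp_avg x\<^sub>0 = \<theta>"
    using exp_avg_attains assms(2,3) by blast
  then obtain c\<^sub>0 where c\<^sub>0: "0 < c\<^sub>0" "exp_avg (c\<^sub>0\<^sup>2) = \<theta>"
    by (metis real_sqrt_gt_zero real_sqrt_pow2 less_imp_le)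
  have root: "0 < x \<and> exp (x\<^sup>2) = 1 / (1 - x\<^sup>2 * \<theta>) \<longleftrightarrow> x = c\<^sub>0" for x
  proof (cases "0 < x")
    case True
    have "exp_avg (x\<^sup>2) = \<theta> \<longleftrightarrow> x = c\<^sub>0"
    proof (cases rule: linorder_cases[of x c\<^sub>0])
      case less
      then show ?thesis
        using exp_avg_strict_antimono[of "x\<^sup>2" "c\<^sub>0\<^sup>2"] True c\<^sub>0 by (simp add: power_strict_mono)
    next
      case greater
      then show ?thesis
        using exp_avg_strict_antimono[of "c\<^sub>0\<^sup>2" "x\<^sup>2"] True c\<^sub>0 by (simp add: power_strict_mono)
    qed (use c\<^sub>0 in simp)
    with True show ?thesis
      by (simp add: exp_square_eq_iff_exp_avg)
  qed (use c\<^sub>0 in auto)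
  let ?V = "limit_profile \<Lambda> c\<^sub>0"
  note fluxV = flux_form_limit_profile[OF \<Lambda> c\<^sub>0(1)]
  have "\<exists>F. flux_form \<Lambda> (c n) (R n) (v n) F
      \<and> (\<forall>x. 0 < x \<longrightarrow> x < R n \<longrightarrow> (F has_real_derivative - (v n x powr \<alpha> n)) (at x))
      \<and> ((\<lambda>s. exp (- c n * s) * F s) has_integral 1 - \<theta>) {0..R n}" for n
    using fb_solution_flux_form[OF \<Lambda> sol[of n]] by blast
  then obtain F where flux: "\<And>n. flux_form \<Lambda> (c n) (R n) (v n) (F n)"
    and F': "\<And>n x. 0 < x \<Longrightarrow> x < R n \<Longrightarrow> (F n has_real_derivative - (v n x powr \<alpha> n)) (at x)"
    and int: "\<And>n. ((\<lambda>s. exp (- c n * s) * F n s) has_integral 1 - \<theta>) {0..R n}"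
    by metis
  have pos: "0 < c n" "0 < R n" and F0: "F n 0 = c n" and contF: "continuous_on {0..R n} (F n)" for n
    using flux[of n] by (auto simp: flux_form_def)
  have v0_I: "v n 0 \<in> I_set \<Lambda> \<theta>" for n
    using sol[of n] by (simp add: fb_solution_def)
  then have v0_le: "v n 0 \<le> 1" for n
    using I_set_le_1 \<Lambda> \<open>0 < \<theta>\<close> by blast
  have lower: "c n - x \<le> F n x" and upper: "F n x \<le> R n - x" and nonneg: "0 \<le> F n x"
    if "x \<in> {0..R n}" for n x
    using power_flux_bounds(3-5)[OF flux[of n] \<Lambda> F' assms(5) less_imp_le[OF v_pos] v0_le that]
    by simp_all
  have c_le_R: "c n \<le> R n" for n
    using upper[of 0 n] pos[of n] F0[of n] by simp
  note avg = flux_integral_bounds[OF pos(1) c_le_R contF int lower upper nonneg]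
  \<comment> \<open>The lower flux bound gives
    \<open>\<theta> \<le> exp_avg ((c n)\<^sup>2)\<close>, and \<open>exp_avg\<close> is strictly
    decreasing, so no speed can exceed the limit speed.\<close>
  have c_le: "c n \<le> c\<^sub>0" for n
  proof (rule ccontr)
    assume "\<not> c n \<le> c\<^sub>0"
    then have "exp_avg ((c n)\<^sup>2) < exp_avg (c\<^sub>0\<^sup>2)"
      using c\<^sub>0 by (intro exp_avg_strict_antimono) (auto intro: power_strict_mono)
    with avg(1)[of n] c\<^sub>0 show False by simp
  qed
  have R_diff: "(\<lambda>n. R n - c n) \<longlonglongrightarrow> 0" and R_le: "eventually (\<lambda>n. R n \<le> c\<^sub>0 + 1) sequentially"
    using power_flux_growth[OF flux \<Lambda> F' assms(5,6) v_pos v0_le]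
    by (intro width_diff_tendsto_zero[OF \<Lambda> assms(5-7) pos(1) c_le_R c_le]; simp)+
  have c_lim: "c \<longlonglongrightarrow> c\<^sub>0"
    using avg(2) c\<^sub>0 by (intro speed_tendsto[OF pos(1) c_le_R c_le R_diff R_le]) simp
  have R_lim: "R \<longlonglongrightarrow> c\<^sub>0"
    using tendsto_add[OF R_diff c_lim] by simp
  \<comment> \<open>This is \<open>\<delta> + \<bar>c - c'\<bar>\<close> from the stability
    estimate, with \<delta> the bound on the flux difference; it is independent of \<open>x\<close>,
    hence the convergence is uniform.\<close>
  define B where "B = (\<lambda>n. (R n - c n) + \<bar>R n - c\<^sub>0\<bar> + \<bar>c n - c\<^sub>0\<bar>)"
  have "B \<longlonglongrightarrow> 0 + \<bar>c\<^sub>0 - c\<^sub>0\<bar> + \<bar>c\<^sub>0 - c\<^sub>0\<bar>"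
    unfolding B_def by (intro tendsto_intros R_diff R_lim c_lim)
  then have B: "B \<longlonglongrightarrow> 0" by simp
  note stability = flux_form_stability[OF flux fluxV \<Lambda> limit_profile_abs_le_1[OF \<Lambda> c\<^sub>0(1)]
      flux_diff_bound[OF _ lower upper nonneg c_le_R], folded B_def]
  have lim: "uniform_limit {0..} (\<lambda>n. zero_ext (R n) (v n)) (zero_ext c\<^sub>0 ?V) sequentially"
  proof (rule uniform_limit_dominated)
    show "\<bar>zero_ext (R n) (v n) x - zero_ext c\<^sub>0 ?V x\<bar> \<le> B n / c n" if "x \<in> {0..}" for n x
      using stability(1)[of n x] that by (simp add: B_def)
    have "(\<lambda>n. B n / c n) \<longlonglongrightarrow> 0 / c\<^sub>0"
      using c\<^sub>0 by (intro tendsto_intros B c_lim) simp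
    then show "(\<lambda>n. B n / c n) \<longlonglongrightarrow> 0" by simp
  qed
  have lim': "uniform_limit {0..} (\<lambda>n x. vector_derivative (zero_ext (R n) (v n)) (at x within {0..}))
      (\<lambda>x. vector_derivative (zero_ext c\<^sub>0 ?V) (at x within {0..})) sequentially"
  proof (rule uniform_limit_dominated)
    show "\<bar>vector_derivative (zero_ext (R n) (v n)) (at x within {0..})
        - vector_derivative (zero_ext c\<^sub>0 ?V) (at x within {0..})\<bar> \<le> 2 * B n / \<Lambda>" if "x \<in> {0..}" for n x
      using stability(2)[of n x] that by (simp add: B_def)
    have "(\<lambda>n. 2 * B n / \<Lambda>) \<longlonglongrightarrow> 2 * 0 / \<Lambda>"
      using \<Lambda> by (intro tendsto_intros B) simp
    then show "(\<lambda>n. 2 * B n / \<Lambda>) \<longlonglongrightarrow> 0" by simp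
  qed
  \<comment> \<open>The condition \<open>v(0) \<in> I\<close> for the limit is inherited because \<open>I\<close> is closed.\<close>
  have "(\<lambda>n. v n 0) \<longlonglongrightarrow> ?V 0"
    using tendsto_uniform_limitI[OF lim, of 0] pos(2) c\<^sub>0(1) by (simp add: zero_ext_def less_imp_le)
  then have "?V 0 \<in> I_set \<Lambda> \<theta>"
    by (rule Lim_in_closed_set[OF closed_I_set _ sequentially_bot, rotated]) (simp add: v0_I)
  with fb_solution_limit_profile[OF \<Lambda> c\<^sub>0] have "fb_solution \<Lambda> \<theta> (\<lambda>_. 1) c\<^sub>0 c\<^sub>0 ?V"
    by blast
  moreover have "\<forall>\<xi>\<in>{0..<c\<^sub>0}. 0 < ?V \<xi>"
    using limit_profile_pos[OF \<Lambda> c\<^sub>0(1)] by simp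
  moreover have "\<forall>c\<^sub>1 R\<^sub>1 v\<^sub>1. fb_solution \<Lambda> \<theta> (\<lambda>_. 1) c\<^sub>1 R\<^sub>1 v\<^sub>1 \<longrightarrow>
      c\<^sub>1 = c\<^sub>0 \<and> R\<^sub>1 = c\<^sub>0 \<and> (\<forall>\<xi>\<in>{0..c\<^sub>0}. v\<^sub>1 \<xi> = ?V \<xi>)"
    using limit_fb_solution_unique[OF \<Lambda> c\<^sub>0] by blast
  ultimately show ?thesis
    using root c_lim R_lim lim lim' unfolding profiles_converge_def by blast
qed

end
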